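(* Let $R\ge 0$ be a real constant and $(Q_i,C_i)$, $i=1,\dots,N$ ($N\ge 0$), real pairs with $Q_i\ge 0$. Then the function $F^t_s=T(Q_1,\dots,Q_N;C_1,\dots,C_N)(t,s)$ generated by the vertex operator $$X(Q_{k+1},C_{k+1})\,T(\boldsymbol Q;\boldsymbol C)=\max\big(T(\boldsymbol Q;\boldsymbol C),\;2\eta_{k+1}+T(\boldsymbol Q;\boldsymbol C-\boldsymbol A_{k+1})\big)$$ solves the ultradiscrete Toda equation: for all $t,s\in\mathbb Z$, $$F^{t}_{s+1}+F^{t+2}_{s+1}=\max\big(F^{t+1}_{s+2}+F^{t+1}_{s}-2R,\;2F^{t+1}_{s+1}\big).$$ In particular $X$ maps $N$-soliton solutions of this equation to $(N+1)$-soliton solutions.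
   Context: Here, for $t,s\in\mathbb Z$, $\eta_i(t,s)=C_i+t\max(Q_i-R,0)-sQ_i$. The interaction terms are $A_{i,j}=\min(Q_i,Q_j)+\max(\min(Q_i,Q_j)-R,0)$ and $\boldsymbol A_{k+1}=(A_{k+1,1},\dots,A_{k+1,k})$. The functions $T(\boldsymbol Q;\boldsymbol C)=T(Q_1,\dots,Q_k;C_1,\dots,C_k)$ on $\mathbb Z^2$ (in the variables $(t,s)$) are defined recursively by $T(;)=0$ and $T(Q_1,\dots,Q_{k+1};C_1,\dots,C_{k+1})=X(Q_{k+1},C_{k+1})T(Q_1,\dots,Q_k;C_1,\dots,C_k)$ with the displayed formula for $X$; these functions are the $k$-soliton solutions. *)

theory Defs
  imports Complex_Main
begin

text \<open>
  Lattice functions \<open>F\<close> have type \<open>int \<Rightarrow> int \<Rightarrow> real\<close>, and \<open>F t s\<close> stands for $F^t_s$.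
  A \<open>k\<close>-tuple $(Q_1,\dots,Q_k)$ is represented by the values at \<open>1, \<dots>, k\<close> of a
  function \<open>nat \<Rightarrow> real\<close>; the values at other indices are never used by \<open>soliton R k\<close>.
\<close>

definition ud_toda :: "real \<Rightarrow> (int \<Rightarrow> int \<Rightarrow> real) \<Rightarrow> bool" where
  "ud_toda R F \<longleftrightarrow>
     (\<forall>t s. F t (s + 1) + F (t + 2) (s + 1)
            = max (F (t + 1) (s + 2) + F (t + 1) s - 2 * R) (2 * F (t + 1) (s + 1)))"

definition phase :: "real \<Rightarrow> real \<Rightarrow> real \<Rightarrow> int \<Rightarrow> int \<Rightarrow> real" where
  "phase R q c t s = c + of_int t * max (q - R) 0 - of_int s * q"

definition interaction :: "real \<Rightarrow> real \<Rightarrow> real \<Rightarrow> real" where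
  "interaction R p q = min p q + max (min p q - R) 0"

text \<open>
  Since the vertex operator shifts the parameters \<open>C\<close>, it acts not on a single lattice
  function but on a whole family \<open>\<Phi>\<close> of lattice functions indexed by the
  parameters \<open>(Q, C)\<close>.
\<close>

definition vertex_op ::
  "real \<Rightarrow> real \<Rightarrow> real
    \<Rightarrow> ((nat \<Rightarrow> real) \<Rightarrow> (nat \<Rightarrow> real) \<Rightarrow> int \<Rightarrow> int \<Rightarrow> real)
    \<Rightarrow> (nat \<Rightarrow> real) \<Rightarrow> (nat \<Rightarrow> real) \<Rightarrow> int \<Rightarrow> int \<Rightarrow> real" where
  "vertex_op R q c \<Phi> Q C t s =
     max (\<Phi> Q C t s)
         (2 * phase R q c t s + \<Phi> Q (\<lambda>i. C i - interaction R q (Q i)) t s)"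

primrec soliton ::
  "real \<Rightarrow> nat \<Rightarrow> (nat \<Rightarrow> real) \<Rightarrow> (nat \<Rightarrow> real) \<Rightarrow> int \<Rightarrow> int \<Rightarrow> real" where
  "soliton R 0 = (\<lambda>Q C t s. 0)"
| "soliton R (Suc k) =
     (\<lambda>Q C. vertex_op R (Q (Suc k)) (C (Suc k)) (soliton R k) Q C)"

end

theory Submission
  imports Defs
begin

text \<open>
  A soliton is the maximum, over subsets \<open>M\<close> of the indices, of
  \<open>2 (\<Sum>i\<in>M. \<eta> i)\<close> minus the interactions of the ordered pairs of distinct elements of \<open>M\<close>.
  In a product of two such exponentials, indexed by \<open>(M, K)\<close>, the indices in \<open>M \<inter> K\<close> are inert,
  so the equation reduces to an optimisation over the ways of splitting the
  symmetric difference \<open>S\<close> into two parts, that is, over signs \<open>\<sigma>\<close> on \<open>S\<close>. Writing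
  \<open>min a b = \<integral> [a > x] [b > x] dx\<close>, the quantity to be maximised becomes an integral over \<open>x\<close> of
  a quadratic in \<open>k = (\<Sum>i | Q i > x. \<sigma> i)\<close>, an integer with the parity of the number of summands.
  The integrand is maximal at every \<open>x\<close> simultaneously if the signs alternate in
  order of decreasing \<open>Q\<close>, starting with \<open>+ -\<close> (for shifts of \<open>t\<close>) or with \<open>+ + -\<close> (for
  shifts of \<open>s\<close>), and both maxima agree as soon as some \<open>Q i\<close> is at least \<open>R\<close>.
  Otherwise the shifts of \<open>t\<close> leave all \<open>\<eta> i\<close> with \<open>i \<in> S\<close> unchanged.
\<close>

section \<open>Weights of index sets\<close>

text \<open>The summand \<open>A i i\<close> cancels the diagonal of the double sum.\<close>

definition weight :: "('a \<Rightarrow> 'a \<Rightarrow> real) \<Rightarrow> ('a \<Rightarrow> real) \<Rightarrow> 'a set \<Rightarrow> real" where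
  "weight A h M = (\<Sum>i\<in>M. 2 * h i + A i i) - (\<Sum>i\<in>M. \<Sum>j\<in>M. A i j)"

lemma weight_empty [simp]: "weight A h {} = 0"
  by (simp add: weight_def)

lemma weight_insert:
  assumes "finite M" "x \<notin> M" "\<And>i j. A i j = A j i"
  shows "weight A h (insert x M) = weight A h M + 2 * h x - 2 * (\<Sum>j\<in>M. A x j)"
proof -
  have "(\<Sum>i\<in>M. A i x) = (\<Sum>j\<in>M. A x j)"
    using assms(3) by (intro sum.cong) auto
  then show ?thesis
    using assms(1,2) by (simp add: weight_def sum.distrib)
qed

text \<open>Isolates the effect of the shift \<open>c\<close>: interactions between \<open>D\<close>
  and \<open>M\<close> only lower the phases on \<open>M\<close>, and \<open>c\<close> enters
  through a sum over \<open>D\<close> and through \<open>weight A c M\<close>.\<close>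

lemma weight_Un:
  assumes "finite D" "finite M" "D \<inter> M = {}" "\<And>i j. A i j = A j i"
  shows "weight A (\<lambda>i. h i + c i) (D \<union> M) =
    weight A h D + 2 * (\<Sum>i\<in>D. c i) + 2 * (\<Sum>i\<in>M. h i - (\<Sum>j\<in>D. A i j)) + weight A c M"
proof -
  have "(\<Sum>i\<in>D. \<Sum>j\<in>M. A i j) = (\<Sum>i\<in>M. \<Sum>j\<in>D. A i j)"
    by (subst sum.swap) (use assms(4) in simp)
  then show ?thesis
    using assms(1-3)
    by (simp add: weight_def sum.union_disjoint sum.distrib sum_subtractf algebra_simps
        flip: sum_distrib_left sum_distrib_right)
qed

text \<open>The quantity to be maximised over splittings: \<open>M\<close> holds the indices of sign
  plus, \<open>K\<close> those of sign minus.\<close>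

definition split_value :: "('a \<Rightarrow> 'a \<Rightarrow> real) \<Rightarrow> ('a \<Rightarrow> real) \<Rightarrow> 'a set \<Rightarrow> 'a set \<Rightarrow> real" where
  "split_value A c M K = weight A c M + weight A (\<lambda>i. - c i) K"

lemma interaction_commute: "interaction R p q = interaction R q p"
  by (simp add: interaction_def min.commute)

text \<open>An index of least \<open>Q\<close> interacts equally with all others, so the loss it
  causes depends only on their number.\<close>

lemma weight_insert_least:
  fixes Q :: "'a \<Rightarrow> real"
  assumes "finite M" "x \<notin> M" "\<And>i. i \<in> M \<Longrightarrow> Q x \<le> Q i"
  shows "weight (\<lambda>i j. interaction R (Q i) (Q j)) h (insert x M) =
    weight (\<lambda>i j. interaction R (Q i) (Q j)) h M + 2 * h x
      - 2 * real (card M) * (Q x + max (Q x - R) 0)"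
proof -
  have "(\<Sum>j\<in>M. interaction R (Q x) (Q j)) = (\<Sum>j\<in>M. Q x + max (Q x - R) 0)"
    using assms(3) by (intro sum.cong) (auto simp: interaction_def min_def)
  then show ?thesis
    using assms by (simp add: weight_insert interaction_commute)
qed

section \<open>Parity and the deficit\<close>

text \<open>
  Here \<open>k\<close> stands for the sum of the signs and \<open>n\<close> for the number of signs chosen so far; \<open>deficit\<close>
  is the integral over \<open>[0, x]\<close> of the gap between the best integrand and the one at \<open>k\<close>. The value
  \<open>\<theta> = 0\<close> belongs to shifts of \<open>t\<close> and \<open>\<theta> = 1\<close> to shifts of \<open>s\<close>.
\<close>

definition deficit :: "real \<Rightarrow> real \<Rightarrow> nat \<Rightarrow> real \<Rightarrow> real \<Rightarrow> real" where
  "deficit R \<theta> n k x =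
    (x - max (x - R) 0) * ((k - 2 * \<theta>)\<^sup>2 - real (n mod 2)) / 2
      + max (x - R) 0 * ((k - 1)\<^sup>2 - (1 - real (n mod 2)))"

text \<open>An integer square is at least the residue of the integer mod 2, and
  \<open>a - b - d\<close> has the parity of \<open>n + \<bar>d\<bar>\<close>.\<close>

lemma square_ge_parity:
  fixes a b n :: nat and d :: int
  assumes "a + b = n"
  shows "real ((n + nat \<bar>d\<bar>) mod 2) \<le> (real a - real b - of_int d)\<^sup>2"
proof -
  let ?k = "int a - int b - d"
  have "int ((n + nat \<bar>d\<bar>) mod 2) \<le> ?k\<^sup>2"
  proof (cases "even (n + nat \<bar>d\<bar>)")
    case False
    then have "odd ?k"
      using assms by (auto simp: even_nat_iff)
    then have "?k \<noteq> 0" by auto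
    then have "1 \<le> ?k\<^sup>2"
      by (smt (verit) zero_less_power2)
    then show ?thesis using False by (simp add: odd_iff_mod_2_eq_one)
  qed (simp add: even_iff_mod_2_eq_zero)
  then have "real_of_int (int ((n + nat \<bar>d\<bar>) mod 2)) \<le> of_int (?k\<^sup>2)"
    by (simp only: of_int_le_iff)
  then show ?thesis by simp
qed

text \<open>The sum of signs has the parity of \<open>n\<close>; subtracting 0 or 2 keeps it and
  subtracting 1 flips it, so both coefficients are nonnegative. Their factors are nondecreasing in
  \<open>x\<close>.\<close>

lemma deficit_mono:
  assumes "a + b = n" "\<theta> = 0 \<or> \<theta> = 1" "0 \<le> R" "x \<le> x'"
  shows "deficit R \<theta> n (real a - real b) x \<le> deficit R \<theta> n (real a - real b) x'"
proof -
  have 1: "real (n mod 2) \<le> (real a - real b - 2 * \<theta>)\<^sup>2"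
    using assms(2) square_ge_parity[OF assms(1), of 0] square_ge_parity[OF assms(1), of 2] by auto
  have 2: "1 - real (n mod 2) \<le> (real a - real b - 1)\<^sup>2"
    using square_ge_parity[OF assms(1), of 1] by (cases "even n") (auto simp: odd_iff_mod_2_eq_one)
  show ?thesis
    unfolding deficit_def
    by (intro add_mono divide_right_mono mult_right_mono) (use 1 2 assms(4) in auto)
qed

lemma deficit_0 [simp]: "0 \<le> R \<Longrightarrow> deficit R \<theta> n k 0 = 0"
  by (simp add: deficit_def)

lemma deficit_Suc:
  "deficit R \<theta> (Suc n) (k + 1) x = deficit R \<theta> n k x
    + (x - max (x - R) 0) * (k - 2 * \<theta> + real (n mod 2))
    + max (x - R) 0 * (2 * k - 2 * real (n mod 2))"
  "deficit R \<theta> (Suc n) (k - 1) x = deficit R \<theta> n k x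
    + (x - max (x - R) 0) * (2 * \<theta> - k + real (n mod 2))
    + max (x - R) 0 * (4 - 2 * k - 2 * real (n mod 2))"
proof -
  define z where "z = max (x - R) 0"
  define a where "a = real (n mod 2)"
  have a': "real (Suc n mod 2) = 1 - a"
    unfolding a_def by (cases "even n") (auto simp: odd_iff_mod_2_eq_one mod_Suc)
  show "deficit R \<theta> (Suc n) (k + 1) x = deficit R \<theta> n k x
      + (x - max (x - R) 0) * (k - 2 * \<theta> + real (n mod 2))
      + max (x - R) 0 * (2 * k - 2 * real (n mod 2))"
    and "deficit R \<theta> (Suc n) (k - 1) x = deficit R \<theta> n k x
      + (x - max (x - R) 0) * (2 * \<theta> - k + real (n mod 2))
      + max (x - R) 0 * (4 - 2 * k - 2 * real (n mod 2))"
    unfolding deficit_def z_def[symmetric] a' a_def[symmetric]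
    by (simp_all add: field_simps power2_eq_square)
qed

section \<open>Optimal splittings\<close>

text \<open>
  \<open>X\<close> and \<open>X'\<close> are the positive parts of the patterns \<open>+ - + -\<close> and \<open>+ + - + -\<close>; the
  cardinalities record the current sums of signs. The induction adds the indices in order of
  decreasing \<open>Q\<close>, and the bound must hold at every \<open>x\<close> below the smallest \<open>Q i\<close> so that it can be
  carried over to the next index.
\<close>

lemma alternating_split:
  fixes R :: real and Q :: "'a \<Rightarrow> real" and S :: "'a set"
  defines "A \<equiv> \<lambda>i j. interaction R (Q i) (Q j)" and "p \<equiv> \<lambda>i. max (Q i - R) 0"
  assumes "finite S" "0 \<le> R" "\<forall>i\<in>S. 0 \<le> Q i"
  shows "\<exists>X Y. X \<union> Y = S \<and> X \<inter> Y = {} \<and> card X = card Y + card S mod 2 \<and>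
    (\<forall>M K \<theta> x. M \<union> K = S \<longrightarrow> M \<inter> K = {} \<longrightarrow> \<theta> = 0 \<or> \<theta> = 1 \<longrightarrow> 0 \<le> x \<longrightarrow> (\<forall>i\<in>S. x \<le> Q i) \<longrightarrow>
      split_value A (\<lambda>i. p i + \<theta> * (Q i - p i)) M K - 2 * \<theta> * R
        + deficit R \<theta> (card S) (real (card M) - real (card K)) x
      \<le> split_value A p X Y) \<and>
    ((\<exists>i\<in>S. R \<le> Q i) \<longrightarrow> (\<exists>X' Y'. X' \<union> Y' = S \<and> X' \<inter> Y' = {} \<and>
      card X' + card S mod 2 = card Y' + 2 \<and>
      split_value A Q X' Y' - 2 * R = split_value A p X Y))"
  using assms(3,5)
proof (induction S rule: finite_ranking_induct[where f = "\<lambda>i. - Q i"])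
  case empty
  \<comment> \<open>For the empty set the deficit is \<open>2 * \<theta> * min x R\<close>, which
    \<open>- 2 * \<theta> * R\<close> absorbs.\<close>
  have "\<theta> * min x R \<le> \<theta> * R" if "\<theta> = 0 \<or> \<theta> = 1" for \<theta> x
    using that by auto
  then show ?case
    using assms(4) by (auto simp: split_value_def deficit_def max_def split: if_splits)
next
  case (insert q S)
  show ?case
  proof (cases "q \<in> S")
    case True
    then show ?thesis using insert by (simp add: insert_absorb)
  next
    case q: False
    have least: "Q q \<le> Q i" if "i \<in> S" for i
      using insert.hyps(2)[OF that] by simp
    have fin: "finite S" by fact
    have "weight A h (insert q M) =
        weight A h M + 2 * h q - 2 * real (card M) * (Q q + p q)" if "M \<subseteq> S" for h M
      unfolding A_def p_def using that q least finite_subset[OF that fin]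
      by (intro weight_insert_least) auto
    then have ins: "split_value A c (insert q M) K =
        split_value A c M K + 2 * c q - 2 * real (card M) * (Q q + p q)"
      "split_value A c K (insert q M) =
        split_value A c K M - 2 * c q - 2 * real (card M) * (Q q + p q)" if "M \<subseteq> S" for c M K
      using that by (simp_all add: split_value_def)
    have "\<forall>i\<in>S. 0 \<le> Q i" using insert.prems by simp
    from insert.IH[OF this]
    obtain X Y where XY: "X \<union> Y = S" "X \<inter> Y = {}" "card X = card Y + card S mod 2"
      and bound: "\<forall>M K \<theta> x. M \<union> K = S \<longrightarrow> M \<inter> K = {} \<longrightarrow> \<theta> = 0 \<or> \<theta> = 1 \<longrightarrow> 0 \<le> x \<longrightarrow>
        (\<forall>i\<in>S. x \<le> Q i) \<longrightarrow>
        split_value A (\<lambda>i. p i + \<theta> * (Q i - p i)) M K - 2 * \<theta> * R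
          + deficit R \<theta> (card S) (real (card M) - real (card K)) x
        \<le> split_value A p X Y"
      and attained: "(\<exists>i\<in>S. R \<le> Q i) \<longrightarrow> (\<exists>X' Y'. X' \<union> Y' = S \<and> X' \<inter> Y' = {} \<and>
        card X' + card S mod 2 = card Y' + 2 \<and>
        split_value A Q X' Y' - 2 * R = split_value A p X Y)"
      by (elim exE conjE) (rule that)
    have card_S': "card (insert q S) = Suc (card S)"
      using q fin by simp
    define o1 where "o1 = real (card S mod 2)"
    have pq: "max (Q q - R) 0 = p q"
      by (simp add: p_def)
    define V where "V = split_value A p X Y"
    \<comment> \<open>The value after giving \<open>q\<close> the next alternating sign: plus if
      \<open>card S\<close> is even, minus if it is odd.\<close>
    define V' where "V' = V + (2 - 4 * o1) * p q - (real (card S) - o1) * (Q q + p q)"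
    have card_split: "card M + card K = card S" if "M \<union> K = S" "M \<inter> K = {}" for M K
      using that fin by (metis card_Un_disjoint finite_Un)
    have bound': "split_value A (\<lambda>i. p i + \<theta> * (Q i - p i)) M K - 2 * \<theta> * R
        + deficit R \<theta> (card (insert q S)) (real (card M) - real (card K)) x \<le> V'"
      if MK: "M \<union> K = insert q S" "M \<inter> K = {}" and \<theta>: "\<theta> = 0 \<or> \<theta> = 1"
        and x: "0 \<le> x" "\<forall>i\<in>insert q S. x \<le> Q i" for M K \<theta> x
    proof -
      have Qq: "0 \<le> Q q" using insert.prems by simp
      have cMK: "card M + card K = card (insert q S)"
        using MK fin by (metis card_Un_disjoint finite_Un finite_insert)
      \<comment> \<open>By monotonicity the bound need only be checked at \<open>Q q\<close>, where
        the induction hypothesis applies because \<open>Q q\<close> is least.\<close>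
      have mono: "deficit R \<theta> (card (insert q S)) (real (card M) - real (card K)) x
          \<le> deficit R \<theta> (card (insert q S)) (real (card M) - real (card K)) (Q q)"
        using \<theta> x assms(4) by (intro deficit_mono[OF cMK]) auto
      consider M0 where "M = insert q M0" "M0 \<union> K = S" "M0 \<inter> K = {}" "q \<notin> M0" "q \<notin> K"
        | K0 where "K = insert q K0" "M \<union> K0 = S" "M \<inter> K0 = {}" "q \<notin> M" "q \<notin> K0"
      proof (cases "q \<in> M")
        case True
        then have "q \<notin> K" using MK(2) by blast
        then have "(M - {q}) \<union> K = (M \<union> K) - {q}" by blast
        also have "\<dots> = S" using MK(1) q by simp
        finally show ?thesis using True MK(2) \<open>q \<notin> K\<close> by (intro that(1)[of "M - {q}"]) auto
      next
        case False
        then have "q \<in> K" using MK(1) by blast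
        have "M \<union> (K - {q}) = (M \<union> K) - {q}" using False by blast
        also have "\<dots> = S" using MK(1) q by simp
        finally show ?thesis using False MK(2) \<open>q \<in> K\<close> by (intro that(2)[of "K - {q}"]) auto
      qed
      then show ?thesis
      proof cases
        case 1
        have sub: "M0 \<subseteq> S" and c: "card M = Suc (card M0)"
          using 1 fin by (auto intro: finite_subset)
        have s: "real (card S) = real (card M0) + real (card K)"
          using card_split[OF 1(2,3)] by simp
        have k: "real (card M) - real (card K) = real (card M0) - real (card K) + 1"
          using c by simp
        \<comment> \<open>The gain from \<open>q\<close> and the change of the deficit at
          \<open>Q q\<close> add up to \<open>V' - V\<close> exactly; the same happens below with
          the other sign.\<close>
        have "split_value A (\<lambda>i. p i + \<theta> * (Q i - p i)) M K - 2 * \<theta> * R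
            + deficit R \<theta> (card (insert q S)) (real (card M) - real (card K)) (Q q) - V'
          = split_value A (\<lambda>i. p i + \<theta> * (Q i - p i)) M0 K - 2 * \<theta> * R
            + deficit R \<theta> (card S) (real (card M0) - real (card K)) (Q q) - V"
          unfolding k card_S' deficit_Suc unfolding 1(1) ins(1)[OF sub] V'_def s
          by (simp add: o1_def[symmetric] pq algebra_simps)
        with bound[rule_format, OF 1(2,3) \<theta> Qq least] mono show ?thesis
          unfolding V_def[symmetric] by linarith
      next
        case 2
        have sub: "K0 \<subseteq> S" and c: "card K = Suc (card K0)"
          using 2 fin by (auto intro: finite_subset)
        have s: "real (card S) = real (card M) + real (card K0)"
          using card_split[OF 2(2,3)] by simp
        have k: "real (card M) - real (card K) = real (card M) - real (card K0) - 1"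
          using c by simp
        have "split_value A (\<lambda>i. p i + \<theta> * (Q i - p i)) M K - 2 * \<theta> * R
            + deficit R \<theta> (card (insert q S)) (real (card M) - real (card K)) (Q q) - V'
          = split_value A (\<lambda>i. p i + \<theta> * (Q i - p i)) M K0 - 2 * \<theta> * R
            + deficit R \<theta> (card S) (real (card M) - real (card K0)) (Q q) - V"
          unfolding k card_S' deficit_Suc unfolding 2(1) ins(2)[OF sub] V'_def s
          by (simp add: o1_def[symmetric] pq algebra_simps)
        with bound[rule_format, OF 2(2,3) \<theta> Qq least] mono show ?thesis
          unfolding V_def[symmetric] by linarith
      qed
    qed
    have sX: "X \<subseteq> S" "Y \<subseteq> S" using XY by auto
    have cXY: "card X + card Y = card S" using card_split XY by blast
    show ?thesis
    proof (cases "even (card S)")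
      case True
      then have e: "o1 = 0" "card X = card Y" "card S mod 2 = 0" "Suc (card S) mod 2 = 1"
        using XY(3) by (auto simp: o1_def mod_Suc)
      have V: "split_value A p (insert q X) Y = V'"
        using e cXY[symmetric] by (simp add: ins(1)[OF sX(1)] V'_def V_def algebra_simps)
      have "\<exists>X' Y'. X' \<union> Y' = insert q S \<and> X' \<inter> Y' = {} \<and>
        card X' + card (insert q S) mod 2 = card Y' + 2 \<and>
        split_value A Q X' Y' - 2 * R = V'"
        if "\<exists>i\<in>insert q S. R \<le> Q i"
      proof (cases "S = {}")
        case True
        \<comment> \<open>Both patterns start with a plus, and \<open>R \<le> Q q\<close> makes
          \<open>2 * Q q - 2 * R\<close> equal to \<open>2 * p q\<close>.\<close>
        then have "R \<le> Q q" "X = {}" "Y = {}" using that XY by auto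
        moreover have "split_value A Q {q} {} = 2 * Q q" "V' = 2 * p q"
          using calculation True e ins(1)[of "{}" Q "{}"] by (simp_all add: V'_def V_def split_value_def)
        ultimately show ?thesis
          using True by (intro exI[of _ "{q}"] exI[of _ "{}"]) (auto simp: p_def)
      next
        case False
        then have "\<exists>i\<in>S. R \<le> Q i" using that least by (metis all_not_in_conv insertE order_trans)
        from attained[rule_format, OF this] obtain X' Y' where
          *: "X' \<union> Y' = S" "X' \<inter> Y' = {}" "card X' + card S mod 2 = card Y' + 2"
          "split_value A Q X' Y' - 2 * R = V"
          unfolding V_def by blast
        have sY: "Y' \<subseteq> S" "q \<notin> X'" "q \<notin> Y'" "finite Y'" using * q fin by (auto intro: finite_subset)
        have "real (card S) = 2 * real (card Y') + 2"
          using card_split[OF *(1,2)] *(3) e by simp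
        \<comment> \<open>From the third index on, the pattern \<open>+ + - + -\<close> has a minus
          at odd positions, so \<open>q\<close> joins \<open>Y'\<close>.\<close>
        then show ?thesis using * e sY
          by (intro exI[of _ X'] exI[of _ "insert q Y'"])
            (auto simp: ins card_S' V'_def algebra_simps)
      qed
      then have attained': "(\<exists>i\<in>insert q S. R \<le> Q i) \<longrightarrow> (\<exists>X' Y'. X' \<union> Y' = insert q S \<and> X' \<inter> Y' = {} \<and>
        card X' + card (insert q S) mod 2 = card Y' + 2 \<and> split_value A Q X' Y' - 2 * R = V')" by blast
      have "insert q X \<union> Y = insert q S" "insert q X \<inter> Y = {}"
        "card (insert q X) = card Y + card (insert q S) mod 2"
        using XY q e card_S' fin by (auto simp: finite_subset[OF sX(1)])
      from this bound'[folded V] attained'[folded V] show ?thesis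
        by - (rule exI[of _ "insert q X"], rule exI[of _ Y], intro conjI allI impI,
            (assumption | blast)+)
    next
      case False
      then have e: "o1 = 1" "card X = card Y + 1" "card S mod 2 = 1" "Suc (card S) mod 2 = 0"
        using XY(3) by (auto simp: o1_def odd_iff_mod_2_eq_one mod_Suc)
      have V: "split_value A p X (insert q Y) = V'"
        using e cXY[symmetric] by (simp add: ins(2)[OF sX(2)] V'_def V_def algebra_simps)
      have "\<exists>X' Y'. X' \<union> Y' = insert q S \<and> X' \<inter> Y' = {} \<and>
        card X' + card (insert q S) mod 2 = card Y' + 2 \<and>
        split_value A Q X' Y' - 2 * R = V'"
        if "\<exists>i\<in>insert q S. R \<le> Q i"
      proof -
        have "S \<noteq> {}" using False by auto
        then have "\<exists>i\<in>S. R \<le> Q i" using that least by (metis all_not_in_conv insertE order_trans)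
        from attained[rule_format, OF this] obtain X' Y' where
          *: "X' \<union> Y' = S" "X' \<inter> Y' = {}" "card X' + card S mod 2 = card Y' + 2"
          "split_value A Q X' Y' - 2 * R = V"
          unfolding V_def by blast
        have sX': "X' \<subseteq> S" "q \<notin> X'" "q \<notin> Y'" "finite X'" using * q fin by (auto intro: finite_subset)
        have "real (card S) = 2 * real (card X') - 1" 
          using card_split[OF *(1,2)] *(3) e by simp
        \<comment> \<open>At even positions this pattern has a plus, where the first one has a
          minus.\<close>
        then show ?thesis using * e sX'
          by (intro exI[of _ "insert q X'"] exI[of _ Y'])
            (auto simp: ins card_S' V'_def algebra_simps)
      qed
      then have attained': "(\<exists>i\<in>insert q S. R \<le> Q i) \<longrightarrow> (\<exists>X' Y'. X' \<union> Y' = insert q S \<and> X' \<inter> Y' = {} \<and>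
        card X' + card (insert q S) mod 2 = card Y' + 2 \<and> split_value A Q X' Y' - 2 * R = V')" by blast
      have "X \<union> insert q Y = insert q S" "X \<inter> insert q Y = {}"
        "card X = card (insert q Y) + card (insert q S) mod 2"
        using XY q e card_S' fin by (auto simp: finite_subset[OF sX(2)])
      from this bound'[folded V] attained'[folded V] show ?thesis
        by - (rule exI[of _ X], rule exI[of _ "insert q Y"], intro conjI allI impI,
            (assumption | blast)+)
    qed
  qed
qed

text \<open>At \<open>x = 0\<close> the deficit vanishes, so the bound for
  \<open>\<theta> = 1\<close> gives the first claim. For the second, the bound for
  \<open>\<theta> = 0\<close> is combined with the splitting \<open>X'\<close>, \<open>Y'\<close>
  that attains the same value.\<close>

lemma split_exchange:
  fixes R :: real and Q :: "'a \<Rightarrow> real" and M K :: "'a set"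
  defines "A \<equiv> \<lambda>i j. interaction R (Q i) (Q j)" and "p \<equiv> \<lambda>i. max (Q i - R) 0"
  assumes "finite (M \<union> K)" "M \<inter> K = {}" "0 \<le> R" "\<forall>i\<in>M \<union> K. 0 \<le> Q i"
  shows "\<exists>X Y. X \<union> Y = M \<union> K \<and> X \<inter> Y = {} \<and>
      split_value A Q M K - 2 * R \<le> split_value A p X Y"
    and "\<exists>i\<in>M \<union> K. R \<le> Q i \<Longrightarrow> \<exists>X Y. X \<union> Y = M \<union> K \<and> X \<inter> Y = {} \<and>
      split_value A p M K \<le> split_value A Q X Y - 2 * R"
proof -
  from alternating_split[OF assms(3,5,6)]
  obtain X Y where XY: "X \<union> Y = M \<union> K" "X \<inter> Y = {}" "card X = card Y + card (M \<union> K) mod 2"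
    and bound: "\<forall>M' K' \<theta> x. M' \<union> K' = M \<union> K \<longrightarrow> M' \<inter> K' = {} \<longrightarrow> \<theta> = 0 \<or> \<theta> = 1 \<longrightarrow> 0 \<le> x \<longrightarrow>
      (\<forall>i\<in>M \<union> K. x \<le> Q i) \<longrightarrow>
      split_value A (\<lambda>i. p i + \<theta> * (Q i - p i)) M' K' - 2 * \<theta> * R
        + deficit R \<theta> (card (M \<union> K)) (real (card M') - real (card K')) x
      \<le> split_value A p X Y"
    and attained: "(\<exists>i\<in>M \<union> K. R \<le> Q i) \<longrightarrow> (\<exists>X' Y'. X' \<union> Y' = M \<union> K \<and> X' \<inter> Y' = {} \<and>
      card X' + card (M \<union> K) mod 2 = card Y' + 2 \<and>
      split_value A Q X' Y' - 2 * R = split_value A p X Y)"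
    unfolding A_def p_def by (elim exE conjE) (rule that[unfolded A_def p_def])
  note bound = bound[rule_format, OF refl assms(4), of _ 0]
  have "split_value A Q M K - 2 * R \<le> split_value A p X Y"
    using bound[of 1] assms(5,6) by simp
  with XY show "\<exists>X Y. X \<union> Y = M \<union> K \<and> X \<inter> Y = {} \<and>
      split_value A Q M K - 2 * R \<le> split_value A p X Y" by blast
  have p: "split_value A p M K \<le> split_value A p X Y"
    using bound[of 0] assms(5,6) by simp
  assume "\<exists>i\<in>M \<union> K. R \<le> Q i"
  from attained[rule_format, OF this] obtain X' Y' where "X' \<union> Y' = M \<union> K" "X' \<inter> Y' = {}"
    "split_value A Q X' Y' - 2 * R = split_value A p X Y"
    by blast
  then show "\<exists>X Y. X \<union> Y = M \<union> K \<and> X \<inter> Y = {} \<and>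
      split_value A p M K \<le> split_value A Q X Y - 2 * R"
    using p by (intro exI[of _ X'] exI[of _ Y']) simp
qed

section \<open>Solitons as maxima of weights\<close>

text \<open>Shifting \<open>C\<close> by the interactions accounts, after doubling, for both orders
  of each pair containing the new index. The two arguments of the maximum thus cover the subsets
  without and with that index.\<close>

lemma weight_soliton:
  defines "w \<equiv> \<lambda>R Q C t s. weight (\<lambda>i j. interaction R (Q i) (Q j)) (\<lambda>i. phase R (Q i) (C i) t s)"
  shows "(\<forall>M\<subseteq>{1..N}. w R Q C t s M \<le> soliton R N Q C t s)
    \<and> (\<exists>M\<subseteq>{1..N}. soliton R N Q C t s = w R Q C t s M)"
proof (induction N arbitrary: C)
  case 0
  then show ?case by (simp add: w_def)
next
  case (Suc N)
  let ?n = "Suc N"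
  let ?C = "\<lambda>i. C i - interaction R (Q ?n) (Q i)"
  have S: "{1..?n} = insert ?n {1..N}" by auto
  have ins: "w R Q C t s (insert ?n M) = 2 * phase R (Q ?n) (C ?n) t s + w R Q ?C t s M"
    if "M \<subseteq> {1..N}" for M
  proof -
    have "finite M" "?n \<notin> M" using that by (auto intro: finite_subset)
    then show ?thesis
      unfolding w_def
      by (subst weight_insert)
        (auto simp: weight_def phase_def sum.distrib sum_subtractf sum_distrib_left
          interaction_commute algebra_simps)
  qed
  have eq: "soliton R ?n Q C t s =
      max (soliton R N Q C t s) (2 * phase R (Q ?n) (C ?n) t s + soliton R N Q ?C t s)"
    by (simp add: vertex_op_def)
  have "w R Q C t s M \<le> soliton R ?n Q C t s" if "M \<subseteq> {1..?n}" for M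
  proof (cases "?n \<in> M")
    case True
    then have "M = insert ?n (M - {?n})" "M - {?n} \<subseteq> {1..N}" using that S by auto
    then have "w R Q C t s M = 2 * phase R (Q ?n) (C ?n) t s + w R Q ?C t s (M - {?n})"
      using ins by metis
    then show ?thesis unfolding eq using Suc[of ?C] \<open>M - {?n} \<subseteq> {1..N}\<close>
      by (simp add: le_max_iff_disj)
  next
    case False
    then have "M \<subseteq> {1..N}" using that S by auto
    then show ?thesis unfolding eq using Suc[of C] by (simp add: le_max_iff_disj)
  qed
  moreover have "\<exists>M\<subseteq>{1..?n}. soliton R ?n Q C t s = w R Q C t s M"
  proof -
    obtain M where M: "M \<subseteq> {1..N}" "soliton R N Q C t s = w R Q C t s M"
      using Suc[of C] by blast
    obtain M' where M': "M' \<subseteq> {1..N}" "soliton R N Q ?C t s = w R Q ?C t s M'"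
      using Suc[of ?C] by blast
    have "M \<subseteq> {1..?n}" "insert ?n M' \<subseteq> {1..?n}" using M(1) M'(1) S by auto
    then show ?thesis unfolding eq M(2) M'(2) ins[OF M'(1), symmetric] max_def by metis
  qed
  ultimately show ?case by blast
qed

lemmas weight_le_soliton = weight_soliton[THEN conjunct1, rule_format]
lemmas soliton_eq_weight = weight_soliton[THEN conjunct2]

section \<open>The Toda equation\<close>

text \<open>Opposite shifts cancel on \<open>M \<inter> K\<close>, and the unshifted terms depend
  only on \<open>M \<inter> K\<close> and the symmetric difference, which regrouping
  preserves.\<close>

lemma weight_pair_exchange:
  fixes A :: "'a \<Rightarrow> 'a \<Rightarrow> real" and h c d :: "'a \<Rightarrow> real"
  assumes "finite M" "finite K" "\<And>i j. A i j = A j i"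
    and XY: "X \<union> Y = (M - K) \<union> (K - M)" "X \<inter> Y = {}"
  shows "weight A (\<lambda>i. h i + d i) (M \<inter> K \<union> X) + weight A (\<lambda>i. h i - d i) (M \<inter> K \<union> Y)
      - (weight A (\<lambda>i. h i + c i) M + weight A (\<lambda>i. h i - c i) K)
    = split_value A d X Y - split_value A c (M - K) (K - M)"
proof -
  let ?D = "M \<inter> K"
  let ?g = "\<lambda>i. h i - (\<Sum>j\<in>?D. A i j)"
  have pair: "weight A (\<lambda>i. h i + e i) (?D \<union> U) + weight A (\<lambda>i. h i - e i) (?D \<union> W) =
      2 * weight A h ?D + 2 * (\<Sum>i\<in>U \<union> W. ?g i) + split_value A e U W"
    if "U \<union> W = (M - K) \<union> (K - M)" "U \<inter> W = {}" for e U W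
  proof -
    have f: "finite U" "finite W" "?D \<inter> U = {}" "?D \<inter> W = {}" "finite ?D"
      using that(1) assms(1,2) by (auto intro: finite_subset)
    show ?thesis
      using weight_Un[OF f(5,1,3) assms(3), where h = h and c = e]
        weight_Un[OF f(5,2,4) assms(3), where h = h and c = "\<lambda>i. - e i"]
        sum.union_disjoint[OF f(1,2) that(2), of ?g]
      by (simp add: split_value_def sum_negf)
  qed
  have "?D \<union> (M - K) = M" "?D \<union> (K - M) = K" "(M - K) \<inter> (K - M) = {}" by auto
  then show ?thesis
    using pair[OF XY, of d] pair[of "M - K" "K - M" c] by (simp add: XY(1))
qed

lemma ud_toda_soliton:
  assumes "R \<ge> 0" "\<forall>i\<in>{1..N}. Q i \<ge> 0"
  shows "ud_toda R (soliton R N Q C)"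
  unfolding ud_toda_def
proof (intro allI)
  fix t s :: int
  let ?F = "soliton R N Q C"
  define A where "A = (\<lambda>i j. interaction R (Q i) (Q j))"
  define p where "p = (\<lambda>i. max (Q i - R) 0)"
  \<comment> \<open>Phases are measured from the centre, so that the four neighbours become the
    shifts by \<open>p\<close>, \<open>- p\<close>, \<open>Q\<close> and \<open>- Q\<close>.\<close>
  define h where "h = (\<lambda>i. phase R (Q i) (C i) (t + 1) (s + 1))"
  have sym: "A i j = A j i" for i j
    by (simp add: A_def interaction_commute)
  have shift:
    "(\<lambda>i. phase R (Q i) (C i) (t + 2) (s + 1)) = (\<lambda>i. h i + p i)"
    "(\<lambda>i. phase R (Q i) (C i) t (s + 1)) = (\<lambda>i. h i - p i)"
    "(\<lambda>i. phase R (Q i) (C i) (t + 1) s) = (\<lambda>i. h i + Q i)"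
    "(\<lambda>i. phase R (Q i) (C i) (t + 1) (s + 2)) = (\<lambda>i. h i - Q i)"
    by (auto simp: h_def p_def phase_def algebra_simps)
  note sol_le = weight_le_soliton[of _ N R Q C, folded A_def]
  note sol_eq = soliton_eq_weight[of N R Q C, folded A_def]
  note tp_le = sol_le[of _ "t + 2" "s + 1", unfolded shift]
  note tm_le = sol_le[of _ t "s + 1", unfolded shift]
  note sp_le = sol_le[of _ "t + 1" s, unfolded shift]
  note sm_le = sol_le[of _ "t + 1" "s + 2", unfolded shift]
  note h_le = sol_le[of _ "t + 1" "s + 1", folded h_def]
  have disj: "(M - K) \<inter> (K - M) = {}" for M K :: "nat set" by blast
  have split: "finite ((M - K) \<union> (K - M))" "\<forall>i\<in>(M - K) \<union> (K - M). 0 \<le> Q i"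
    "finite M" "finite K"
    if "M \<subseteq> {1..N}" "K \<subseteq> {1..N}" for M K
    using that assms(2) by (auto intro: finite_subset)
  show "?F t (s + 1) + ?F (t + 2) (s + 1)
      = max (?F (t + 1) (s + 2) + ?F (t + 1) s - 2 * R) (2 * ?F (t + 1) (s + 1))"
  proof (rule antisym)
    obtain M K where MK: "M \<subseteq> {1..N}" "K \<subseteq> {1..N}"
      and F: "?F (t + 2) (s + 1) = weight A (\<lambda>i. h i + p i) M"
        "?F t (s + 1) = weight A (\<lambda>i. h i - p i) K"
      using sol_eq[of "t + 2" "s + 1"] sol_eq[of t "s + 1"] unfolding shift by blast
    let ?S = "(M - K) \<union> (K - M)"
    note fin = split[OF MK]
    show "?F t (s + 1) + ?F (t + 2) (s + 1)
      \<le> max (?F (t + 1) (s + 2) + ?F (t + 1) s - 2 * R) (2 * ?F (t + 1) (s + 1))"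
    \<comment> \<open>If some \<open>Q i\<close> reaches \<open>R\<close>, the pair is regrouped for
      shifts of \<open>s\<close>. Otherwise \<open>p\<close> vanishes on \<open>?S\<close>, and
      \<open>M\<close>, \<open>K\<close> themselves compare with the term
      \<open>2 * ?F (t + 1) (s + 1)\<close>.\<close>
    proof (cases "\<exists>i\<in>?S. R \<le> Q i")
      case True
      obtain X' Y' where XY': "X' \<union> Y' = ?S" "X' \<inter> Y' = {}"
        and max: "split_value A p (M - K) (K - M) \<le> split_value A Q X' Y' - 2 * R"
        using split_exchange(2)[OF fin(1) disj assms(1) fin(2) True, folded A_def p_def] by blast
      have "M \<inter> K \<union> X' \<subseteq> {1..N}" "M \<inter> K \<union> Y' \<subseteq> {1..N}"
        using MK XY'(1) by auto
      with sp_le[of "M \<inter> K \<union> X'"] sm_le[of "M \<inter> K \<union> Y'"]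
        weight_pair_exchange[where A = A and h = h and d = Q and c = p, OF fin(3,4) sym XY'(1,2)]
        max
      show ?thesis unfolding F by simp
    next
      case False
      then have "\<And>i. i \<in> ?S \<Longrightarrow> Q i \<le> R" using linear by blast
      then have "\<forall>i\<in>?S. p i = 0" unfolding p_def by (metis diff_le_0_iff_le max.absorb2)
      then have "split_value A p (M - K) (K - M) = split_value A (\<lambda>i. 0) (M - K) (K - M)"
        by (auto simp: split_value_def weight_def intro!: arg_cong2[of _ _ _ _ "(+)"] sum.cong)
      moreover have "M \<inter> K \<union> (M - K) = M" "M \<inter> K \<union> (K - M) = K" by auto
      ultimately show ?thesis
        using weight_pair_exchange[where A = A and h = h and d = "\<lambda>i. 0" and c = p, OF fin(3,4) sym refl disj]
          h_le[OF MK(1)] h_le[OF MK(2)]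
        unfolding F by (auto simp: le_max_iff_disj)
    qed
  next
    obtain M K where MK: "M \<subseteq> {1..N}" "K \<subseteq> {1..N}"
      and F: "?F (t + 1) s = weight A (\<lambda>i. h i + Q i) M"
        "?F (t + 1) (s + 2) = weight A (\<lambda>i. h i - Q i) K"
      using sol_eq[of "t + 1" s] sol_eq[of "t + 1" "s + 2"] unfolding shift by blast
    let ?S = "(M - K) \<union> (K - M)"
    note fin = split[OF MK]
    obtain X Y where XY: "X \<union> Y = ?S" "X \<inter> Y = {}"
      and max: "split_value A Q (M - K) (K - M) - 2 * R \<le> split_value A p X Y"
      using split_exchange(1)[OF fin(1) disj assms(1) fin(2), folded A_def p_def] by blast
    have "M \<inter> K \<union> X \<subseteq> {1..N}" "M \<inter> K \<union> Y \<subseteq> {1..N}"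
      using MK XY(1) by auto
    with tp_le[of "M \<inter> K \<union> X"] tm_le[of "M \<inter> K \<union> Y"]
      weight_pair_exchange[where A = A and h = h and d = p and c = Q, OF fin(3,4) sym XY(1,2)]
      max
    have 1: "?F (t + 1) (s + 2) + ?F (t + 1) s - 2 * R \<le> ?F t (s + 1) + ?F (t + 2) (s + 1)"
      unfolding F by simp
    \<comment> \<open>Shifting one optimal set at the centre by \<open>p\<close> and by
      \<open>- p\<close> leaves the total weight unchanged.\<close>
    obtain L where L: "L \<subseteq> {1..N}" "?F (t + 1) (s + 1) = weight A h L"
      using sol_eq[of "t + 1" "s + 1"] unfolding h_def by blast
    have "weight A (\<lambda>i. h i + p i) L + weight A (\<lambda>i. h i - p i) L = 2 * weight A h L"
      by (simp add: weight_def sum.distrib sum_subtractf sum_distrib_left algebra_simps)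
    then have "2 * ?F (t + 1) (s + 1) \<le> ?F t (s + 1) + ?F (t + 2) (s + 1)"
      using tp_le[OF L(1)] tm_le[OF L(1)] L(2) by simp
    with 1 show "max (?F (t + 1) (s + 2) + ?F (t + 1) s - 2 * R) (2 * ?F (t + 1) (s + 1))
      \<le> ?F t (s + 1) + ?F (t + 2) (s + 1)" by simp
  qed
qed

section \<open>The vertex operator on solitons\<close>

lemma soliton_cong:
  assumes "\<And>i. i \<in> {1..N} \<Longrightarrow> Q i = Q' i" "\<And>i. i \<in> {1..N} \<Longrightarrow> C i = C' i"
  shows "soliton R N Q C = soliton R N Q' C'"
  using assms
proof (induction N arbitrary: C C')
  case (Suc N)
  have "soliton R N Q (\<lambda>i. C i - interaction R (Q (Suc N)) (Q i)) =
      soliton R N Q' (\<lambda>i. C' i - interaction R (Q' (Suc N)) (Q' i))"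
    using Suc.prems by (intro Suc.IH) auto
  moreover have "soliton R N Q C = soliton R N Q' C'"
    using Suc.prems by (intro Suc.IH) auto
  ultimately show ?case
    using Suc.prems by (auto simp: vertex_op_def fun_eq_iff)
qed simp

theorem mainTheorem4:
  fixes R :: real and N :: nat and Q C :: "nat \<Rightarrow> real"
  assumes "R \<ge> 0"
    and "\<forall>i\<in>{1..N}. Q i \<ge> 0"
  shows "ud_toda R (soliton R N Q C) \<and>
         (\<forall>q c. q \<ge> 0 \<longrightarrow>
            vertex_op R q c (soliton R N) Q C
              = soliton R (Suc N) (Q(Suc N := q)) (C(Suc N := c)) \<and>
            ud_toda R (vertex_op R q c (soliton R N) Q C))"
proof (intro conjI allI impI)
  show "ud_toda R (soliton R N Q C)"
    using assms by (rule ud_toda_soliton)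
next
  fix q c :: real
  assume "q \<ge> 0"
  let ?Q = "Q(Suc N := q)" and ?C = "C(Suc N := c)"
  \<comment> \<open>The \<open>N\<close>-soliton does not see entry \<open>Suc N\<close>, so the
    vertex operator is the recursion step for the extended parameters.\<close>
  have "soliton R N ?Q ?C = soliton R N Q C"
    by (intro soliton_cong) auto
  moreover have "soliton R N ?Q (\<lambda>i. ?C i - interaction R q (?Q i)) =
      soliton R N Q (\<lambda>i. C i - interaction R q (Q i))"
    by (intro soliton_cong) auto
  ultimately show eq: "vertex_op R q c (soliton R N) Q C = soliton R (Suc N) ?Q ?C"
    by (simp add: vertex_op_def fun_eq_iff)
  have "ud_toda R (soliton R (Suc N) ?Q ?C)"
    using assms \<open>q \<ge> 0\<close> by (intro ud_toda_soliton) auto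
  then show "ud_toda R (vertex_op R q c (soliton R N) Q C)"
    using eq by simp
qed

end
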